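(* Let $\boldsymbol{k}=(k_1,\ldots,k_r)$ be an admissible index and let $l$ be a positive integer with $l\le r$. Assume that for all $m=0,\ldots,r-1$, $$\max_{\substack{1\leq j\leq r\\ |\boldsymbol{e}|=m\\ e_1,\ldots,e_{r}\leq1\\ e_l=0}}\{r-2j+2-(k_j+e_j+\cdots+k_r+e_r)\}<-m,$$ where the maximum is over all $j$ and all $\boldsymbol{e}=(e_1,\ldots,e_r)\in\mathbb{Z}_{\ge0}^r$ with the indicated properties. Then for $s\in\mathbb{C}$ (as an identity of meromorphic functions of $s$), $$\sum_{j=0}^{r-1}(-1)^{j}\sum_{\substack{|\boldsymbol{e}|=j\\ e_1,\ldots,e_{r}\leq1\\ e_l=0}}I_{\boldsymbol{k}+\boldsymbol{e}}(s-j) =\zeta(k_1,\ldots,k_{l-1},k_l+s,k_{l+1},\ldots,k_r),$$ where the inner sum is over $\boldsymbol{e}=(e_1,\ldots,e_r)\in\mathbb{Z}_{\ge0}^r$ with the indicated properties.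
   Context: An index $(k_1,\ldots,k_r)$ of positive integers is admissible if $k_r\ge 2$. For $\boldsymbol{e}=(e_1,\ldots,e_r)\in\mathbb{Z}_{\ge 0}^r$, $|\boldsymbol{e}|=e_1+\cdots+e_r$ and $\boldsymbol{k}+\boldsymbol{e}=(k_1+e_1,\ldots,k_r+e_r)$. For an admissible index $\boldsymbol{k}$ and $\Re(s)>-1$, the Ohno function is defined by the absolutely convergent series $$I_{\boldsymbol{k}}(s):=\sum_{i=1}^{r}\ \sum_{0<n_1<\cdots<n_r} \frac{1}{n_1^{k_1}\cdots n_r^{k_r}}\cdot \frac{1}{n_i^{s}} \prod_{\substack{1\le j\le r\\ j\ne i}} \frac{n_j}{ n_j-n_i },$$ and it extends meromorphically to all $s\in\mathbb{C}$ (the same symbol denotes the continuation). The series in fact converges absolutely to this function whenever $\max_{1\leq j\leq r}\{r-2j+2-(k_j+\cdots+k_r)\}<\Re(s)$. The multiple zeta function is $\zeta(s_1,\ldots,s_r)=\sum_{0<n_1<\cdots<n_r} n_1^{-s_1}\cdots n_r^{-s_r}$, which converges absolutely when $\Re(s_j+\cdots+s_r)>r-j+1$ for all $1\le j\le r$, and is extended by meromorphic continuation; the right-hand side is regarded as a meromorphic function of $s\in\mathbb{C}$. *)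

theory Defs
  imports "HOL-Complex_Analysis.Complex_Analysis"
begin

text \<open>
  An index \<open>(k\<^sub>1,\<dots>,k\<^sub>r)\<close> is a list of length \<open>r \<ge> 1\<close>. Lists are indexed from \<open>0\<close>, so that
  \<open>k\<^sub>j\<close> is \<open>k ! (j - 1)\<close> and \<open>k\<^sub>j + \<dots> + k\<^sub>r\<close> is \<open>sum_list (drop (j - 1) k)\<close>.
\<close>

definition admissible :: "nat list \<Rightarrow> bool" where
  "admissible k \<longleftrightarrow> k \<noteq> [] \<and> (\<forall>a\<in>set k. a > 0) \<and> last k \<ge> 2"

definition add_index :: "nat list \<Rightarrow> nat list \<Rightarrow> nat list" where
  "add_index k e = map2 (+) k e"

definition increasing_tuples :: "nat \<Rightarrow> nat list set" where
  "increasing_tuples r = {n. length n = r \<and> (\<forall>a\<in>set n. 0 < a) \<and> sorted_wrt (<) n}"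

definition ohno_series :: "nat list \<Rightarrow> complex \<Rightarrow> complex" where
  "ohno_series k s =
     (\<Sum>i<length k. \<Sum>\<^sub>\<infinity>n\<in>increasing_tuples (length k).
        1 / (\<Prod>j<length k. of_nat (n ! j) ^ (k ! j))
        * (1 / of_nat (n ! i) powr s)
        * (\<Prod>j\<in>{..<length k} - {i}. of_nat (n ! j) / (of_nat (n ! j) - of_nat (n ! i))))"

definition mzeta_series :: "complex list \<Rightarrow> complex" where
  "mzeta_series s =
     (\<Sum>\<^sub>\<infinity>n\<in>increasing_tuples (length s). \<Prod>j<length s. of_nat (n ! j) powr (- (s ! j)))"

definition mzeta_domain :: "complex list set" where
  "mzeta_domain =
     {s. \<forall>j\<in>{1..length s}. Re (sum_list (drop (j - 1) s)) > real (length s) - real j + 1}"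

definition meromorphic_continuation ::
    "(complex \<Rightarrow> complex) \<Rightarrow> complex set \<Rightarrow> (complex \<Rightarrow> complex) \<Rightarrow> bool" where
  "meromorphic_continuation f D F \<longleftrightarrow> F meromorphic_on UNIV \<and> (\<forall>s\<in>D. F s = f s)"

text \<open>
  \<open>mzeta_along p\<close> is the multiple zeta function restricted to a complex line \<open>p\<close> in \<open>\<complex>\<^sup>r\<close>, as a
  meromorphic function of the parameter of the line. It is obtained by continuing the series from
  the part of the line on which it converges. If that part is a nonempty half-plane, the result is
  determined up to its values on a sparse set, in particular at poles, where a HOL function also
  has a value.
\<close>

definition mzeta_along :: "(complex \<Rightarrow> complex list) \<Rightarrow> complex \<Rightarrow> complex" where
  "mzeta_along p =
     (SOME F. meromorphic_continuation (\<lambda>s. mzeta_series (p s)) {s. p s \<in> mzeta_domain} F)"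

definition shift_entry :: "nat list \<Rightarrow> nat \<Rightarrow> complex \<Rightarrow> complex list" where
  "shift_entry k l s = (map of_nat k)[l - 1 := of_nat (k ! (l - 1)) + s]"

definition shifts :: "nat \<Rightarrow> nat \<Rightarrow> nat \<Rightarrow> nat list set" where
  "shifts r l m = {e. length e = r \<and> sum_list e = m \<and> (\<forall>a\<in>set e. a \<le> 1) \<and> e ! (l - 1) = 0}"

definition abscissa :: "nat list \<Rightarrow> nat \<Rightarrow> int" where
  "abscissa k j = int (length k) - 2 * int j + 2 - int (sum_list (drop (j - 1) k))"

end

theory Submission
  imports Defs
begin

text \<open>
  The identity holds term by term. Fix the tuple \<open>n\<close> and the index \<open>i\<close> of a summand of the Ohno
  series. Replacing \<open>k\<close> by \<open>k + e\<close> and \<open>s\<close> by \<open>s - |e|\<close> multiplies that summand by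
  \<open>\<Prod>\<^sub>m (n\<^sub>i / n\<^sub>m)\<^bsup>e\<^sub>m\<^esup>\<close>, so the alternating sum over all \<open>e\<close> with entries in \<open>{0, 1}\<close> and \<open>e\<^sub>l = 0\<close>
  multiplies it by \<open>\<Prod>\<^bsub>m \<noteq> l\<^esub> (1 - n\<^sub>i / n\<^sub>m)\<close> (lemma \<open>sum_shifts_prod\<close>). If \<open>i \<noteq> l\<close>, the factor
  with \<open>m = i\<close> kills the summand. If \<open>i = l\<close>, the product is the reciprocal of the partial-fraction
  product of the Ohno summand, and exactly the summand of the multiple zeta series is left
  (lemma \<open>sum_ohno_terms\<close>).

  The terms may be rearranged where every series converges absolutely. Distinct positive
  integers satisfy \<open>|n\<^sub>j / (n\<^sub>j - n\<^sub>i)| \<le> 2 n\<^sub>i\<close>, so once \<open>Re s\<close> is at least \<open>r - 1\<close> the factor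
  \<open>n\<^sub>i\<^bsup>-s\<^esup>\<close> absorbs the whole partial-fraction product, and an Ohno summand is at most a constant times
  a summand of \<open>\<zeta>(k)\<close>. This gives the identity on the half-plane \<open>Re s > 2 r\<close>
  (lemma \<open>sum_ohno_series_eq_mzeta_series\<close>).

  It remains to pass to all of \<open>\<complex>\<close>. The multiple zeta series is holomorphic on the open convex set
  \<open>D\<close> of those \<open>s\<close> where its exponents lie in the domain of convergence. The left-hand side is
  meromorphic on \<open>\<complex>\<close>, because the Ohno functions are, and it agrees with the series on a half-plane
  inside \<open>D\<close>. With its removable singularities removed it is therefore a meromorphic continuation of
  the series from \<open>D\<close> (lemma \<open>remove_sings_meromorphic_continuation\<close>). So a continuation exists, the
  choice in \<open>mzeta_along\<close> selects one, and any two agree off a sparse set by the identity theorem.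
\<close>

section \<open>Absolute convergence of multiple zeta series\<close>

text \<open>
  Abel summation in inductive form: the sum is a combination of the increments of \<open>x\<close>, weighted by
  the tail sums of \<open>u\<close>. Moving \<open>x 0\<close> down to \<open>a\<close> is the boundary step, and a free \<open>a\<close> makes the
  induction go through.
\<close>
lemma sum_mult_le_if_tail_sums_nonpos:
  fixes u x :: "nat \<Rightarrow> real"
  assumes "\<And>j. j < r \<Longrightarrow> (\<Sum>i=j..<r. u i) \<le> 0"
    and "\<And>i. Suc i < r \<Longrightarrow> x i \<le> x (Suc i)"
    and "0 < r \<Longrightarrow> a \<le> x 0"
  shows "(\<Sum>i<r. u i * x i) \<le> a * (\<Sum>i<r. u i)"
  using assms
proof (induction r arbitrary: u x a)
  case 0
  then show ?case by simp
next
  case (Suc r)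
  have tails: "(\<Sum>i=j..<r. u (Suc i)) \<le> 0" if "j < r" for j
    using Suc.prems(1)[of "Suc j"] that by (simp only: sum.shift_bounds_Suc_ivl)
  have "(\<Sum>i<r. u (Suc i) * x (Suc i)) \<le> x 0 * (\<Sum>i<r. u (Suc i))"
    by (rule Suc.IH[of "\<lambda>i. u (Suc i)" "\<lambda>i. x (Suc i)" "x 0"])
       (use Suc.prems(2) tails in auto)
  then have "(\<Sum>i<Suc r. u i * x i) \<le> x 0 * (\<Sum>i<Suc r. u i)"
    unfolding sum.lessThan_Suc_shift by (simp add: algebra_simps)
  also have "\<dots> \<le> a * (\<Sum>i<Suc r. u i)"
    using Suc.prems(1)[of 0] Suc.prems(3)
    by (intro mult_right_mono_neg) (simp_all add: atLeast0LessThan del: sum.lessThan_Suc)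
  finally show ?case .
qed

lemma increasing_tuplesD:
  assumes "n \<in> increasing_tuples r"
  shows "length n = r" "\<And>j. j < r \<Longrightarrow> 0 < n ! j" "\<And>i j. i < j \<Longrightarrow> j < r \<Longrightarrow> n ! i < n ! j"
  using assms by (auto simp: increasing_tuples_def sorted_wrt_iff_nth_less)

text \<open>
  Along increasing tuples only the tail sums of the exponents matter for upper bounds: with
  \<open>n\<^sub>0 = 1\<close>, the product is \<open>\<Prod>\<^sub>j (n\<^sub>j / n\<^bsub>j-1\<^esub>)\<^bsup>-T\<^sub>j\<^esup>\<close>, where \<open>T\<^sub>j\<close> is the \<open>j\<close>-th tail sum, and it decreases in
  each \<open>T\<^sub>j\<close>. So one may flatten all exponents to a common \<open>c\<close>, which turns the domain of convergence
  into the condition \<open>c > 1\<close>. The proof takes logarithms and sums by parts.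
\<close>
lemma prod_powr_le_prod_powr_const:
  fixes t :: "nat \<Rightarrow> real"
  assumes n: "n \<in> increasing_tuples r"
    and tails: "\<And>j. j < r \<Longrightarrow> (real r - real j) * c \<le> (\<Sum>i=j..<r. t i)"
  shows "(\<Prod>j<r. real (n ! j) powr (- t j)) \<le> (\<Prod>j<r. real (n ! j) powr (- c))"
proof -
  note n' = increasing_tuplesD[OF n]
  have exp_form: "(\<Prod>j<r. real (n ! j) powr (- w j)) = exp (\<Sum>j<r. - w j * ln (real (n ! j)))" for w
    unfolding exp_sum[OF finite_lessThan] using n'(2) by (intro prod.cong) (auto simp: powr_def)
  have "(\<Sum>j<r. (c - t j) * ln (real (n ! j))) \<le> 0 * (\<Sum>j<r. c - t j)"
  proof (rule sum_mult_le_if_tail_sums_nonpos)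
    show "(\<Sum>i=j..<r. c - t i) \<le> 0" if "j < r" for j
      using tails[OF that] that by (simp add: sum_subtractf of_nat_diff)
    show "ln (real (n ! i)) \<le> ln (real (n ! Suc i))" if "Suc i < r" for i
      using n'(2)[of i] n'(3)[of i "Suc i"] that by simp
    show "0 \<le> ln (real (n ! 0))" if "0 < r"
      using n'(2)[of 0] that by (intro ln_ge_zero) simp
  qed
  then show ?thesis
    unfolding exp_form by (simp add: left_diff_distrib sum_subtractf sum_negf)
qed

lemma summable_on_prod_lists:
  fixes f :: "'a \<Rightarrow> real"
  assumes f: "f summable_on A" and nonneg: "\<And>x. x \<in> A \<Longrightarrow> 0 \<le> f x"
  shows "(\<lambda>xs. \<Prod>j<r. f (xs ! j)) summable_on {xs. length xs = r \<and> set xs \<subseteq> A}"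
proof (induction r)
  case 0
  have "{xs. length xs = 0 \<and> set xs \<subseteq> A} = {[]}" by auto
  then show ?case by simp
next
  case (Suc r)
  let ?L = "\<lambda>r. {xs. length xs = r \<and> set xs \<subseteq> A}"
  let ?g = "\<lambda>xs. \<Prod>j<r. f (xs ! j)"
  have L_Suc: "?L (Suc r) = (\<lambda>(x, xs). x # xs) ` (A \<times> ?L r)"
    by (force simp: length_Suc_conv image_iff)
  have "(\<lambda>(x, xs). f x * ?g xs) summable_on A \<times> ?L r"
  proof (rule summable_on_SigmaI)
    show "((\<lambda>y. case (x, y) of (x, xs) \<Rightarrow> f x * ?g xs) has_sum f x * infsum ?g (?L r)) (?L r)" for x
      using has_sum_cmult_right[OF has_sum_infsum[OF Suc.IH]] by simp
    show "(\<lambda>x. f x * infsum ?g (?L r)) summable_on A"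
      by (rule summable_on_cmult_left[OF f])
    show "0 \<le> (case (x, xs) of (x, xs) \<Rightarrow> f x * ?g xs)" if "x \<in> A" "xs \<in> ?L r" for x xs
      using that by (auto intro!: mult_nonneg_nonneg prod_nonneg nonneg dest: nth_mem)
  qed
  also have "?this \<longleftrightarrow> ((\<lambda>xs. \<Prod>j<Suc r. f (xs ! j)) \<circ> (\<lambda>(x, xs). x # xs)) summable_on A \<times> ?L r"
    by (intro summable_on_cong) (auto simp: prod.lessThan_Suc_shift simp del: prod.lessThan_Suc)
  also have "\<dots> \<longleftrightarrow> (\<lambda>xs. \<Prod>j<Suc r. f (xs ! j)) summable_on ?L (Suc r)"
    unfolding L_Suc by (rule summable_on_reindex[symmetric]) (auto simp: inj_on_def)
  finally show ?case .
qed

lemma summable_on_increasing_prod_powr_const: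
  assumes "c > 1"
  shows "(\<lambda>n. \<Prod>j<r. real (n ! j) powr (- c)) summable_on increasing_tuples r"
proof -
  have "(\<lambda>m. real m powr (- c)) summable_on UNIV"
    using assms by (intro norm_summable_imp_summable_on) (simp add: summable_real_powr_iff)
  then have "(\<lambda>n. \<Prod>j<r. real (n ! j) powr (- c)) summable_on {n. length n = r \<and> set n \<subseteq> UNIV}"
    by (rule summable_on_prod_lists) simp
  then show ?thesis
    by (rule summable_on_subset_banach) (auto simp: increasing_tuples_def)
qed

text \<open>
  Finitely many strict inequalities hold with room to spare. The spare room is shared between an
  exponent \<open>c > 1\<close>, for summability, and a margin \<open>d\<close> by which the tail sums may still drop, for
  uniformity in a neighbourhood.
\<close>
lemma exponent_gap:
  fixes T :: "nat \<Rightarrow> real"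
  assumes "\<And>j. j < r \<Longrightarrow> real r - real j < T j"
  obtains c d where "c > 1" "d > 0" "\<And>j. j < r \<Longrightarrow> (real r - real j) * c \<le> T j - d"
proof -
  define \<eta> where "\<eta> = Min (insert 1 ((\<lambda>j. T j - (real r - real j)) ` {..<r}))"
  have \<eta>: "\<eta> > 0"
    unfolding \<eta>_def using assms by (subst Min_gr_iff) (auto simp: less_diff_eq)
  have \<eta>_le: "\<eta> \<le> T j - (real r - real j)" if "j < r" for j
    unfolding \<eta>_def using that by (intro Min_le) auto
  define y where "y = \<eta> / (2 * real (Suc r))"
  have y: "y > 0" "real (Suc r) * y = \<eta> / 2"
    using \<eta> by (simp_all add: y_def field_simps)
  show thesis
  proof (rule that[of "1 + y" "\<eta> / 2"])
    fix j assume j: "j < r"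
    have "(real r - real j) * (1 + y) = (real r - real j) + (real r - real j) * y"
      by (simp add: distrib_left)
    also have "(real r - real j) * y \<le> real (Suc r) * y"
      using y by (intro mult_right_mono) auto
    finally show "(real r - real j) * (1 + y) \<le> T j - \<eta> / 2"
      using \<eta>_le[OF j] unfolding y(2) by linarith
  qed (use \<eta> y in auto)
qed

lemma summable_on_increasing_prod_powr:
  assumes "\<And>j. j < r \<Longrightarrow> real r - real j < (\<Sum>i=j..<r. t i)"
  shows "(\<lambda>n. \<Prod>j<r. real (n ! j) powr (- t j)) summable_on increasing_tuples r"
proof -
  obtain c d where cd: "c > 1" "d > 0" "\<And>j. j < r \<Longrightarrow> (real r - real j) * c \<le> (\<Sum>i=j..<r. t i) - d"
    using exponent_gap[of r "\<lambda>j. \<Sum>i=j..<r. t i"] assms by metis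
  show ?thesis
  proof (rule summable_on_comparison_test[OF summable_on_increasing_prod_powr_const[OF cd(1)]])
    show "(\<Prod>j<r. real (n ! j) powr (- t j)) \<le> (\<Prod>j<r. real (n ! j) powr (- c))"
      if "n \<in> increasing_tuples r" for n
      using cd(2,3) by (intro prod_powr_le_prod_powr_const[OF that]) force
  qed (auto intro: prod_nonneg)
qed

section \<open>The multiple zeta function along a coordinate line\<close>

lemma sum_list_drop_conv_sum:
  "sum_list (drop j xs) = (\<Sum>i=j..<length xs. xs ! i)"
proof (cases "j \<le> length xs")
  case True
  have "sum_list (drop j xs) = (\<Sum>i=0..<length xs - j. xs ! (i + j))"
    using True by (simp add: sum_list_sum_nth add.commute)
  also have "\<dots> = (\<Sum>i=j..<length xs. xs ! i)"
    using sum.shift_bounds_nat_ivl[of "\<lambda>i. xs ! i" 0 j "length xs - j"] True by simp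
  finally show ?thesis .
qed simp

lemma mzeta_domain_iff:
  "s \<in> mzeta_domain \<longleftrightarrow>
     (\<forall>j<length s. real (length s) - real j < (\<Sum>i=j..<length s. Re (s ! i)))"
proof -
  have "s \<in> mzeta_domain \<longleftrightarrow>
    (\<forall>j\<in>Suc ` {..<length s}. real (length s) - real j + 1 < Re (sum_list (drop (j - 1) s)))"
    unfolding mzeta_domain_def image_Suc_lessThan by simp
  then show ?thesis by (auto simp: sum_list_drop_conv_sum Re_sum)
qed

lemma shift_entry_nth:
  assumes "j < length k"
  shows "shift_entry k l s ! j = of_nat (k ! j) + (if j = l - 1 then s else 0)"
  using assms by (auto simp: shift_entry_def nth_list_update)

lemma length_shift_entry [simp]: "length (shift_entry k l s) = length k"
  by (simp add: shift_entry_def)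

text \<open>
  A tail sum of the exponents grows with \<open>Re s\<close> or does not depend on \<open>s\<close>, according to whether the
  tail contains the shifted entry. Hence the domain of convergence on the line is closed under
  increasing the real part, and a drop of \<open>Re s\<close> by \<open>d\<close> costs at most \<open>d\<close> in each tail sum.
\<close>
lemma shift_entry_tail_sums_mono:
  assumes "0 \<le> d" "Re s - d \<le> Re z" and r: "r = length k"
  shows "(\<Sum>i=j..<r. Re (shift_entry k l s ! i)) - d \<le> (\<Sum>i=j..<r. Re (shift_entry k l z ! i))"
proof -
  have eq: "(\<Sum>i=j..<r. Re (shift_entry k l w ! i))
      = (\<Sum>i=j..<r. real (k ! i)) + (if l - 1 \<in> {j..<r} then Re w else 0)" for w
  proof -
    have "(\<Sum>i=j..<r. Re (shift_entry k l w ! i))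
        = (\<Sum>i=j..<r. real (k ! i) + (if i = l - 1 then Re w else 0))"
      by (intro sum.cong) (auto simp: shift_entry_nth r)
    then show ?thesis by (simp add: sum.distrib)
  qed
  show ?thesis unfolding eq using assms by auto
qed

lemma shift_entry_mzeta_domain_mono:
  assumes "shift_entry k l s \<in> mzeta_domain" "Re s \<le> Re z"
  shows "shift_entry k l z \<in> mzeta_domain"
  using assms shift_entry_tail_sums_mono[of 0 s z "length k" k l]
  unfolding mzeta_domain_iff by (force intro: less_le_trans)

text \<open>Connectedness is what the identity theorem asks for; convexity is a direct way to it.\<close>
lemma convex_shift_entry_mzeta_domain: "convex {s. shift_entry k l s \<in> mzeta_domain}" (is "convex ?D")
proof (rule convexI)
  fix x y :: complex and u v :: real
  assume xy: "x \<in> ?D" "y \<in> ?D" and uv: "0 \<le> u" "0 \<le> v" "u + v = 1"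
  define m where "m = min (Re x) (Re y)"
  have "m = u * m + v * m"
    using uv by (simp flip: distrib_right)
  also have "\<dots> \<le> u * Re x + v * Re y"
    using uv by (intro add_mono mult_left_mono) (auto simp: m_def)
  finally have "m \<le> Re (u *\<^sub>R x + v *\<^sub>R y)" by simp
  then have "Re x \<le> Re (u *\<^sub>R x + v *\<^sub>R y) \<or> Re y \<le> Re (u *\<^sub>R x + v *\<^sub>R y)"
    by (auto simp: m_def min_def split: if_splits)
  then show "u *\<^sub>R x + v *\<^sub>R y \<in> ?D"
    using xy shift_entry_mzeta_domain_mono by blast
qed

text \<open>
  Weierstrass's criterion on a disc around \<open>s\<close>. Its radius is the margin by which the tail sums at
  \<open>s\<close> may drop while one summable majorant with constant exponent \<open>c > 1\<close> still dominates all terms.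
\<close>
lemma mzeta_series_shift_entry_holomorphic_near:
  assumes s: "shift_entry k l s \<in> mzeta_domain"
  obtains d where "d > 0" "cball s d \<subseteq> {z. shift_entry k l z \<in> mzeta_domain}"
    "(\<lambda>z. mzeta_series (shift_entry k l z)) holomorphic_on ball s d"
proof -
  define r where "r = length k"
  define F where "F n z = (\<Prod>j<r. of_nat (n ! j) powr (- (shift_entry k l z ! j)))"
    for n :: "nat list" and z :: complex
  obtain c d where cd: "c > 1" "d > 0"
      "\<And>j. j < r \<Longrightarrow> (real r - real j) * c \<le> (\<Sum>i=j..<r. Re (shift_entry k l s ! i)) - d"
    using exponent_gap[of r "\<lambda>j. \<Sum>i=j..<r. Re (shift_entry k l s ! i)"] s
    unfolding mzeta_domain_iff r_def length_shift_entry by metis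
  have near: "Re s - d \<le> Re z" if "z \<in> cball s d" for z
    using that abs_Re_le_cmod[of "s - z"] by (simp add: dist_norm)
  have tails: "(real r - real j) * c \<le> (\<Sum>i=j..<r. Re (shift_entry k l z ! i))"
    if "j < r" "z \<in> cball s d" for j z
    using cd(3)[OF that(1)] shift_entry_tail_sums_mono[OF _ near[OF that(2)] r_def, of l j] cd(2) by linarith
  have dom: "cball s d \<subseteq> {z. shift_entry k l z \<in> mzeta_domain}"
  proof (rule subsetI, unfold mem_Collect_eq mzeta_domain_iff length_shift_entry, intro allI impI)
    fix z j assume z: "z \<in> cball s d" and j: "j < length k"
    have "real r - real j < (real r - real j) * c"
      using cd(1) j by (simp add: r_def)
    also have "\<dots> \<le> (\<Sum>i=j..<length k. Re (shift_entry k l z ! i))"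
      using tails[of j z] z j by (simp add: r_def)
    finally show "real (length k) - real j < (\<Sum>i=j..<length k. Re (shift_entry k l z ! i))"
      by (simp add: r_def)
  qed
  have bound: "norm (F n z) \<le> (\<Prod>j<r. real (n ! j) powr (- c))"
    if n: "n \<in> increasing_tuples r" and z: "z \<in> cball s d" for n z
  proof -
    have "norm (F n z) = (\<Prod>j<r. real (n ! j) powr (- Re (shift_entry k l z ! j)))"
      unfolding F_def prod_norm[symmetric] by (intro prod.cong) (auto simp: norm_powr_real_powr)
    also have "\<dots> \<le> (\<Prod>j<r. real (n ! j) powr (- c))"
      using tails z by (intro prod_powr_le_prod_powr_const[OF n]) blast
    finally show ?thesis .
  qed
  have unif: "uniform_limit (cball s d) (\<lambda>X z. \<Sum>n\<in>X. F n z)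
      (\<lambda>z. \<Sum>\<^sub>\<infinity>n\<in>increasing_tuples r. F n z) (finite_subsets_at_top (increasing_tuples r))"
    using bound summable_on_increasing_prod_powr_const[OF cd(1)]
    by (rule Weierstrass_m_test_general)
  have F_hol: "F n holomorphic_on UNIV" if n: "n \<in> increasing_tuples r" for n
  proof -
    have "(\<lambda>z. \<Prod>j<r. of_nat (n ! j) powr (- (of_nat (k ! j) + (if j = l - 1 then z else 0))))
        holomorphic_on UNIV"
    proof (rule holomorphic_on_prod)
      show "(\<lambda>z. of_nat (n ! j) powr (- (of_nat (k ! j) + (if j = l - 1 then z else 0))))
          holomorphic_on UNIV" for j
        by (cases "j = l - 1") (auto intro!: holomorphic_intros)
    qed
    then show ?thesis
      by (rule holomorphic_transform) (simp add: F_def shift_entry_nth r_def)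
  qed
  have part: "(\<lambda>z. \<Sum>n\<in>X. F n z) holomorphic_on UNIV" if "X \<subseteq> increasing_tuples r" for X
    using F_hol that by (intro holomorphic_on_sum) blast
  have ev: "\<forall>\<^sub>F X in finite_subsets_at_top (increasing_tuples r).
      continuous_on (cball s d) (\<lambda>z. \<Sum>n\<in>X. F n z) \<and> (\<lambda>z. \<Sum>n\<in>X. F n z) holomorphic_on ball s d"
  proof (rule eventually_finite_subsets_at_top_weakI, rule conjI)
    fix X assume "X \<subseteq> increasing_tuples r"
    note hol = holomorphic_on_subset[OF part[OF this] subset_UNIV]
    show "continuous_on (cball s d) (\<lambda>z. \<Sum>n\<in>X. F n z)"
      by (rule holomorphic_on_imp_continuous_on[OF hol])
    show "(\<lambda>z. \<Sum>n\<in>X. F n z) holomorphic_on ball s d"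
      by (rule hol)
  qed
  have "(\<lambda>z. \<Sum>\<^sub>\<infinity>n\<in>increasing_tuples r. F n z) holomorphic_on ball s d"
    by (rule holomorphic_uniform_limit[OF ev unif]) auto
  then have "(\<lambda>z. mzeta_series (shift_entry k l z)) holomorphic_on ball s d"
    unfolding mzeta_series_def F_def r_def by simp
  then show thesis by (rule that[OF cd(2) dom])
qed

lemma open_shift_entry_mzeta_domain: "open {s. shift_entry k l s \<in> mzeta_domain}"
  unfolding open_contains_cball
proof
  fix s assume "s \<in> {s. shift_entry k l s \<in> mzeta_domain}"
  then have "shift_entry k l s \<in> mzeta_domain" by simp
  then obtain d where "d > 0" "cball s d \<subseteq> {s. shift_entry k l s \<in> mzeta_domain}"
    by (rule mzeta_series_shift_entry_holomorphic_near)
  then show "\<exists>d>0. cball s d \<subseteq> {s. shift_entry k l s \<in> mzeta_domain}" by blast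
qed

lemma mzeta_series_shift_entry_holomorphic:
  "(\<lambda>s. mzeta_series (shift_entry k l s)) holomorphic_on {s. shift_entry k l s \<in> mzeta_domain}"
  unfolding holomorphic_on_def
proof
  fix s assume "s \<in> {s. shift_entry k l s \<in> mzeta_domain}"
  then have "shift_entry k l s \<in> mzeta_domain" by simp
  then obtain d where d: "d > 0" "(\<lambda>z. mzeta_series (shift_entry k l z)) holomorphic_on ball s d"
    by (rule mzeta_series_shift_entry_holomorphic_near)
  have "(\<lambda>z. mzeta_series (shift_entry k l z)) field_differentiable at s"
    by (rule holomorphic_on_imp_differentiable_at[OF d(2) open_ball]) (use d(1) in simp)
  then show "(\<lambda>z. mzeta_series (shift_entry k l z)) field_differentiable
      at s within {s. shift_entry k l s \<in> mzeta_domain}"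
    by (rule field_differentiable_at_within)
qed

section \<open>Absolute convergence of the Ohno series for large real part\<close>

text \<open>
  The last entry is at least \<open>2\<close> and the others at least \<open>1\<close>, so an admissible index lies strictly
  inside the domain of convergence.
\<close>
lemma admissible_tail_sums:
  assumes "admissible k" "j < length k"
  shows "length k - j < (\<Sum>i=j..<length k. k ! i)"
proof -
  obtain q where q: "length k = Suc q" and j: "j \<le> q"
    using assms(2) by (cases "length k") auto
  have pos: "1 \<le> k ! i" if "i < length k" for i
    using assms(1) that by (auto simp: admissible_def Suc_le_eq)
  have "k ! q \<ge> 2"
    using assms(1) q by (auto simp: admissible_def last_conv_nth)
  moreover have "(\<Sum>i=j..<q. 1) \<le> (\<Sum>i=j..<q. k ! i)"
    by (intro sum_mono pos) (auto simp: q)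
  ultimately show ?thesis
    using j unfolding q by simp
qed

lemma summable_on_admissible:
  assumes "admissible k" and r: "r = length k"
  shows "(\<lambda>n. \<Prod>j<r. 1 / real (n ! j) ^ (k ! j)) summable_on increasing_tuples r"
proof -
  have "(\<lambda>n. \<Prod>j<r. real (n ! j) powr (- real (k ! j))) summable_on increasing_tuples r"
  proof (rule summable_on_increasing_prod_powr)
    fix j assume j: "j < r"
    then have "real (r - j) < real (\<Sum>i=j..<r. k ! i)"
      using admissible_tail_sums[OF assms(1)] unfolding r of_nat_less_iff by blast
    then show "real r - real j < (\<Sum>i=j..<r. real (k ! i))"
      using j by (simp add: of_nat_diff)
  qed
  also have "?this \<longleftrightarrow> ?thesis"
    using increasing_tuplesD(2)
    by (intro summable_on_cong prod.cong) (auto simp: powr_minus powr_realpow divide_simps)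
  finally show ?thesis .
qed

definition ohno_term :: "nat list \<Rightarrow> complex \<Rightarrow> nat \<Rightarrow> nat list \<Rightarrow> complex" where
  "ohno_term k s i n =
     1 / (\<Prod>j<length k. of_nat (n ! j) ^ (k ! j))
     * (1 / of_nat (n ! i) powr s)
     * (\<Prod>j\<in>{..<length k} - {i}. of_nat (n ! j) / (of_nat (n ! j) - of_nat (n ! i)))"

lemma ohno_series_conv_ohno_term:
  "ohno_series k s = (\<Sum>i<length k. \<Sum>\<^sub>\<infinity>n\<in>increasing_tuples (length k). ohno_term k s i n)"
  by (simp add: ohno_series_def ohno_term_def)

text \<open>Write \<open>m / (m - p) = 1 + p / (m - p)\<close> and use that the denominator is a nonzero integer.\<close>
lemma norm_partial_fraction_factor_le:
  fixes m p :: nat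
  assumes "m \<noteq> p" "p > 0"
  shows "norm (of_nat m / (of_nat m - of_nat p) :: complex) \<le> 2 * real p"
proof -
  have ne: "(of_nat m - of_nat p :: complex) \<noteq> 0" using assms by simp
  have "norm (of_nat m - of_nat p :: complex) = real_of_int \<bar>int m - int p\<bar>"
    by (metis norm_of_int of_int_diff of_int_of_nat_eq of_int_abs)
  then have ge1: "1 \<le> norm (of_nat m - of_nat p :: complex)" using assms(1) by linarith
  have "of_nat m / (of_nat m - of_nat p :: complex) = 1 + of_nat p / (of_nat m - of_nat p)"
    using ne by (simp add: field_simps)
  also have "norm \<dots> \<le> 1 + real p / norm (of_nat m - of_nat p :: complex)"
    by (rule norm_triangle_le) (simp add: norm_divide)
  also have "\<dots> \<le> 1 + real p / 1"
    using ge1 by (intro add_left_mono divide_left_mono) auto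
  also have "\<dots> \<le> 2 * real p" using assms(2) by simp
  finally show ?thesis .
qed

text \<open>
  There are \<open>r - 1\<close> partial-fraction factors, each at most \<open>2 n\<^sub>i\<close>, so \<open>|n\<^sub>i\<^bsup>-s\<^esup>| \<le> n\<^sub>i\<^bsup>-(r-1)\<^esup>\<close> absorbs all of
  them. This reduces the convergence of the Ohno series to that of \<open>\<zeta>(k)\<close>.
\<close>
lemma norm_ohno_term_le:
  assumes n: "n \<in> increasing_tuples r" and r: "r = length k" and i: "i < r"
    and s: "real r - 1 \<le> Re s"
  shows "norm (ohno_term k s i n) \<le> 2 ^ (r - 1) * (\<Prod>j<r. 1 / real (n ! j) ^ (k ! j))"
proof -
  note n' = increasing_tuplesD[OF n]
  define N where "N = real (n ! i)"
  have N: "N \<ge> 1" using n'(2)[OF i] by (simp add: N_def)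
  define P where "P = (\<Prod>j\<in>{..<r} - {i}. of_nat (n ! j) / (of_nat (n ! j) - of_nat (n ! i)) :: complex)"
  have distinct: "n ! j \<noteq> n ! i" if "j < r" "j \<noteq> i" for j
    using n'(3) that i by (metis nat_neq_iff)
  have "norm P \<le> (\<Prod>j\<in>{..<r} - {i}. 2 * N)"
    unfolding P_def prod_norm[symmetric] N_def
    using distinct n'(2)[OF i] by (intro prod_mono) (auto intro!: norm_partial_fraction_factor_le)
  also have "\<dots> = 2 ^ (r - 1) * N powr (real r - 1)"
    using i N by (simp add: power_mult_distrib flip: powr_realpow)
  also have "\<dots> \<le> 2 ^ (r - 1) * N powr Re s"
    using s N by (intro mult_left_mono powr_mono) auto
  finally have P: "norm P \<le> 2 ^ (r - 1) * N powr Re s" .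
  have "norm (ohno_term k s i n) = (\<Prod>j<r. 1 / real (n ! j) ^ (k ! j)) * (norm P / N powr Re s)"
    unfolding ohno_term_def P_def r[symmetric] N_def norm_mult norm_divide prod_norm[symmetric]
    by (simp add: norm_power norm_powr_real_powr prod_dividef)
  also have "\<dots> \<le> (\<Prod>j<r. 1 / real (n ! j) ^ (k ! j)) * 2 ^ (r - 1)"
    using P N by (intro mult_left_mono prod_nonneg) (auto simp: field_simps)
  finally show ?thesis by (simp add: mult.commute)
qed

lemma summable_on_ohno_term:
  assumes "admissible k" "r = length k" "i < r" "real r - 1 \<le> Re s"
  shows "ohno_term k s i summable_on increasing_tuples r"
proof (rule abs_summable_summable)
  show "(\<lambda>n. norm (ohno_term k s i n)) summable_on increasing_tuples r"
    by (rule Infinite_Sum.abs_summable_on_comparison_test'[OF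
          summable_on_cmult_right[OF summable_on_admissible[OF assms(1,2)], where c = "2 ^ (r - 1)"]])
       (use norm_ohno_term_le assms in auto)
qed

section \<open>The termwise identity\<close>

lemma add_index_nth:
  assumes "length e = length k" "j < length k"
  shows "add_index k e ! j = k ! j + e ! j"
  using assms by (simp add: add_index_def)

lemma length_add_index:
  assumes "length e = length k"
  shows "length (add_index k e) = length k"
  using assms by (simp add: add_index_def)

lemma admissible_add_index:
  assumes k: "admissible k" and e: "length e = length k"
  shows "admissible (add_index k e)"
proof -
  have ne: "k \<noteq> []" "add_index k e \<noteq> []"
    using k length_add_index[OF e] by (auto simp: admissible_def)
  have "last (add_index k e) = last k + e ! (length k - 1)"
    using ne e by (simp add: last_conv_nth length_add_index add_index_nth)
  moreover have "0 < add_index k e ! j" if "j < length k" for j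
    using k that e by (simp add: admissible_def add_index_nth)
  ultimately show ?thesis
    using k ne e unfolding admissible_def
    by (auto simp: in_set_conv_nth length_add_index)
qed

text \<open>
  The product on the right, multiplied out: choosing the summand \<open>- x m\<close> for \<open>m \<in> X\<close> and \<open>1\<close> elsewhere
  contributes the term of the indicator vector \<open>e\<close> of \<open>X\<close>. The condition \<open>e\<^sub>l = 0\<close> says that \<open>X\<close>
  avoids \<open>l\<close>, so \<open>|e|\<close> is at most \<open>r - 1\<close> and the outer sum misses nothing.
\<close>
lemma sum_shifts_prod:
  fixes x :: "nat \<Rightarrow> 'a :: comm_ring_1"
  assumes l: "l \<in> {1..r}"
  shows "(\<Sum>j=0..r - 1. (-1) ^ j * (\<Sum>e\<in>shifts r l j. \<Prod>m<r. x m ^ (e ! m)))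
       = (\<Prod>m\<in>{..<r} - {l - 1}. 1 - x m)"
proof -
  define A where "A = {..<r} - {l - 1}"
  have "l - 1 \<in> {..<r}" using l by auto
  then have card_A: "card A = r - 1" by (simp add: A_def card_Diff_singleton)
  \<comment> \<open>The indicator vector of \<open>X\<close>; it translates subsets of \<open>A\<close> of size \<open>j\<close> into shifts of weight \<open>j\<close>.\<close>
  define h where "h X = map (\<lambda>m. of_bool (m \<in> X) :: nat) [0..<r]" for X
  have h_nth: "h X ! m = of_bool (m \<in> X)" if "m < r" for X m
    using that by (simp add: h_def)
  have sum_h: "sum_list (h X) = card X" if "X \<subseteq> A" for X
  proof -
    have "sum_list (h X) = (\<Sum>m\<in>{..<r}. of_bool (m \<in> X))"
      by (simp add: h_def interv_sum_list_conv_sum_set_nat atLeast0LessThan)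
    also have "\<dots> = card ({..<r} \<inter> X)"
      by (simp only: of_bool_def card_eq_sum sum.inter_restrict[OF finite_lessThan])
    also have "{..<r} \<inter> X = X" using that by (auto simp: A_def)
    finally show ?thesis .
  qed
  have shifts_eq: "bij_betw h {X \<in> Pow A. card X = j} (shifts r l j)" for j
  proof (rule bij_betw_byWitness[where f' = "\<lambda>e. {m. m < r \<and> e ! m = 1}"])
    show "\<forall>X\<in>{X \<in> Pow A. card X = j}. {m. m < r \<and> h X ! m = 1} = X"
    proof
      fix X assume "X \<in> {X \<in> Pow A. card X = j}"
      then have "X \<subseteq> {..<r}" by (auto simp: A_def)
      moreover have "h X ! m = 1 \<longleftrightarrow> m \<in> X" if "m < r" for m
        using h_nth[OF that, of X] by simp
      ultimately show "{m. m < r \<and> h X ! m = 1} = X" by blast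
    qed
    have hinv: "h {m. m < r \<and> e ! m = 1} = e" if "e \<in> shifts r l j" for e
    proof (rule nth_equalityI)
      have len: "length e = r" and le: "\<forall>a\<in>set e. a \<le> 1"
        using that by (auto simp: shifts_def)
      show "length (h {m. m < r \<and> e ! m = 1}) = length e"
        by (simp add: len h_def)
      fix m assume "m < length (h {m. m < r \<and> e ! m = 1})"
      then have m: "m < r" by (simp add: h_def)
      then have "e ! m \<in> set e" using len by simp
      then have "e ! m = 0 \<or> e ! m = 1" using le by force
      then show "h {m. m < r \<and> e ! m = 1} ! m = e ! m" using m by (auto simp: h_nth)
    qed
    then show "\<forall>e\<in>shifts r l j. h {m. m < r \<and> e ! m = 1} = e" by blast
    show "h ` {X \<in> Pow A. card X = j} \<subseteq> shifts r l j"
    proof clarify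
      fix X assume X: "X \<subseteq> A" "j = card X"
      have "h X ! (l - 1) = 0"
        using X(1) \<open>l - 1 \<in> {..<r}\<close> by (auto simp: h_nth A_def)
      moreover have "length (h X) = r" "\<forall>a\<in>set (h X). a \<le> 1"
        by (auto simp: h_def)
      ultimately show "h X \<in> shifts r l (card X)"
        using sum_h[OF X(1)] by (simp add: shifts_def)
    qed
    show "(\<lambda>e. {m. m < r \<and> e ! m = 1}) ` shifts r l j \<subseteq> {X \<in> Pow A. card X = j}"
    proof clarify
      fix e assume e: "e \<in> shifts r l j"
      have sub: "{m. m < r \<and> e ! m = 1} \<subseteq> A"
        using e by (auto simp: shifts_def A_def)
      moreover have "card {m. m < r \<and> e ! m = 1} = j"
        using sum_h[OF sub] e unfolding hinv[OF e] by (simp add: shifts_def)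
      ultimately show "{m. m < r \<and> e ! m = 1} \<in> Pow A \<and> card {m. m < r \<and> e ! m = 1} = j"
        by blast
    qed
  qed
  have prod_h: "(\<Prod>m<r. x m ^ (h X ! m)) = (\<Prod>m\<in>X. x m)" if "X \<subseteq> A" for X
  proof -
    have "(\<Prod>m<r. x m ^ (h X ! m)) = (\<Prod>m<r. if m \<in> X then x m else 1)"
      by (intro prod.cong) (auto simp: h_nth)
    also have "\<dots> = prod x ({..<r} \<inter> X)" by (rule prod.inter_restrict[symmetric]) simp
    also have "{..<r} \<inter> X = X" using that by (auto simp: A_def)
    finally show ?thesis .
  qed
  have "(\<Sum>j=0..r - 1. (-1) ^ j * (\<Sum>e\<in>shifts r l j. \<Prod>m<r. x m ^ (e ! m)))
      = (\<Sum>j=0..r - 1. \<Sum>X\<in>{X \<in> Pow A. card X = j}. \<Prod>m\<in>X. - x m)"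
  proof (intro sum.cong refl)
    fix j
    have "(\<Sum>e\<in>shifts r l j. \<Prod>m<r. x m ^ (e ! m))
        = (\<Sum>X\<in>{X \<in> Pow A. card X = j}. \<Prod>m<r. x m ^ (h X ! m))"
      by (rule sum.reindex_bij_betw[OF shifts_eq, symmetric])
    then show "(-1) ^ j * (\<Sum>e\<in>shifts r l j. \<Prod>m<r. x m ^ (e ! m))
        = (\<Sum>X\<in>{X \<in> Pow A. card X = j}. \<Prod>m\<in>X. - x m)"
      by (simp add: prod_h sum_distrib_left prod_uminus)
  qed
  also have "\<dots> = (\<Sum>X\<in>Pow A. \<Prod>m\<in>X. - x m)"
  proof (rule sum.group)
    show "card ` Pow A \<subseteq> {0..r - 1}"
      unfolding card_A[symmetric] using card_mono[of A] by (force simp: A_def)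
  qed (simp_all add: A_def)
  also have "\<dots> = (\<Prod>m\<in>A. 1 - x m)"
    using prod_add[of A "\<lambda>m. - x m" "\<lambda>_. 1"] by (simp add: A_def)
  finally show ?thesis unfolding A_def .
qed

text \<open>
  The shift \<open>s - |e|\<close> supplies one factor \<open>n\<^sub>i\<close> for each unit of \<open>e\<close>, which pairs with the extra
  denominators \<open>n\<^sub>m\<close>; the partial-fraction product does not depend on the index.
\<close>
lemma ohno_term_add_index:
  assumes n: "n \<in> increasing_tuples r" and r: "r = length k" and i: "i < r"
    and e: "length e = r" "sum_list e = j"
  shows "ohno_term (add_index k e) (s - of_nat j) i n
       = ohno_term k s i n * (\<Prod>m<r. (of_nat (n ! i) / of_nat (n ! m)) ^ (e ! m))"
proof -
  have ni: "n ! i \<noteq> 0" using increasing_tuplesD(2)[OF n i] by simp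
  have "(\<Prod>m<r. (of_nat (n ! i) / of_nat (n ! m)) ^ (e ! m))
      = (of_nat (n ! i) ^ j / (\<Prod>m<r. of_nat (n ! m) ^ (e ! m)) :: complex)"
    using e by (simp add: power_divide prod_dividef sum_list_sum_nth atLeast0LessThan flip: power_sum)
  moreover have "(\<Prod>m<r. of_nat (n ! m) ^ (add_index k e ! m))
      = (\<Prod>m<r. of_nat (n ! m) ^ (k ! m)) * (\<Prod>m<r. of_nat (n ! m) ^ (e ! m) :: complex)"
    using e r by (simp add: add_index_nth power_add prod.distrib)
  moreover have "complex_of_nat (n ! i) powr (s - of_nat j) = of_nat (n ! i) powr s / of_nat (n ! i) ^ j"
    using ni by (simp add: powr_diff)
  ultimately show ?thesis
    using e r unfolding ohno_term_def by (simp add: length_add_index mult_ac)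
qed

text \<open>
  The heart of the theorem. After expansion, the summand with index \<open>i\<close> carries the factor
  \<open>\<Prod>\<^bsub>m \<noteq> l\<^esub> (1 - n\<^sub>i / n\<^sub>m)\<close>. It vanishes for \<open>i \<noteq> l\<close>, and for \<open>i = l\<close> it cancels the
  product of the \<open>n\<^sub>m / (n\<^sub>m - n\<^sub>l)\<close>.
\<close>
lemma sum_ohno_terms:
  assumes n: "n \<in> increasing_tuples r" and r: "r = length k" and l: "l \<in> {1..r}"
  shows "(\<Sum>j=0..r - 1. (-1) ^ j *
            (\<Sum>e\<in>shifts r l j. \<Sum>i<r. ohno_term (add_index k e) (s - of_nat j) i n))
       = (\<Prod>j<r. of_nat (n ! j) powr (- (shift_entry k l s ! j)))"
proof -
  note n' = increasing_tuplesD[OF n]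
  have n_neq: "n ! j \<noteq> 0" if "j < r" for j
    using n'(2)[OF that] by simp
  have l': "l - 1 < r" using l by auto
  define x where "x i m = (of_nat (n ! i) / of_nat (n ! m) :: complex)" for i m
  have "(\<Sum>j=0..r - 1. (-1) ^ j *
            (\<Sum>e\<in>shifts r l j. \<Sum>i<r. ohno_term (add_index k e) (s - of_nat j) i n))
      = (\<Sum>j=0..r - 1. (-1) ^ j *
            (\<Sum>e\<in>shifts r l j. \<Sum>i<r. ohno_term k s i n * (\<Prod>m<r. x i m ^ (e ! m))))"
    unfolding x_def using ohno_term_add_index[OF n r]
    by (intro sum.cong arg_cong2[where f = "(*)"]) (auto simp: shifts_def)
  also have "\<dots> = (\<Sum>j=0..r - 1. \<Sum>i<r. (-1) ^ j *
            (ohno_term k s i n * (\<Sum>e\<in>shifts r l j. \<Prod>m<r. x i m ^ (e ! m))))"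
    by (subst sum.swap) (simp add: sum_distrib_left)
  also have "\<dots> = (\<Sum>i<r. ohno_term k s i n *
            (\<Sum>j=0..r - 1. (-1) ^ j * (\<Sum>e\<in>shifts r l j. \<Prod>m<r. x i m ^ (e ! m))))"
    by (subst sum.swap) (simp add: sum_distrib_left mult.left_commute)
  also have "\<dots> = (\<Sum>i<r. ohno_term k s i n * (\<Prod>m\<in>{..<r} - {l - 1}. 1 - x i m))"
    by (simp only: sum_shifts_prod[OF l])
  also have "\<dots> = (\<Sum>i\<in>{l - 1}. ohno_term k s i n * (\<Prod>m\<in>{..<r} - {l - 1}. 1 - x i m))"
  proof (rule sum.mono_neutral_right)
    show "\<forall>i\<in>{..<r} - {l - 1}. ohno_term k s i n * (\<Prod>m\<in>{..<r} - {l - 1}. 1 - x i m) = 0"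
    proof
      fix i assume i: "i \<in> {..<r} - {l - 1}"
      then have "1 - x i i = 0" using n'(2)[of i] by (simp add: x_def)
      then show "ohno_term k s i n * (\<Prod>m\<in>{..<r} - {l - 1}. 1 - x i m) = 0"
        using i by (intro mult_eq_0_iff[THEN iffD2] disjI2 prod_zero) auto
    qed
  qed (use l in auto)
  also have "\<dots> = 1 / (\<Prod>j<r. of_nat (n ! j) ^ (k ! j)) * (1 / of_nat (n ! (l - 1)) powr s)"
  proof -
    have "(\<Prod>j\<in>{..<r} - {l - 1}. of_nat (n ! j) / (of_nat (n ! j) - of_nat (n ! (l - 1))))
        * (\<Prod>m\<in>{..<r} - {l - 1}. 1 - x (l - 1) m) = 1"
      unfolding prod.distrib[symmetric]
    proof (intro prod.neutral ballI)
      fix m assume m: "m \<in> {..<r} - {l - 1}"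
      then have "n ! m \<noteq> n ! (l - 1)" "n ! m \<noteq> 0"
        using n'(2)[of m] n'(3)[of m "l - 1"] n'(3)[of "l - 1" m] l by (cases "m < l - 1"; force)+
      then show "of_nat (n ! m) / (of_nat (n ! m) - of_nat (n ! (l - 1))) * (1 - x (l - 1) m) = 1"
        by (simp add: x_def field_simps)
    qed
    then show ?thesis by (simp add: ohno_term_def r[symmetric] mult.assoc)
  qed
  also have "\<dots> = (\<Prod>j<r. of_nat (n ! j) powr (- (shift_entry k l s ! j)))"
  proof -
    have "(\<Prod>j<r. of_nat (n ! j) powr (- (shift_entry k l s ! j)))
        = (\<Prod>j<r. 1 / of_nat (n ! j) ^ (k ! j)
             * (if j = l - 1 then 1 / of_nat (n ! (l - 1)) powr s else 1 :: complex))"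
    proof (rule prod.cong[OF refl])
      fix j assume j: "j \<in> {..<r}"
      then have "complex_of_nat (n ! j) \<noteq> 0" using n_neq by auto
      then show "complex_of_nat (n ! j) powr (- (shift_entry k l s ! j)) = 1 / of_nat (n ! j) ^ (k ! j)
             * (if j = l - 1 then 1 / of_nat (n ! (l - 1)) powr s else 1)"
        using j by (auto simp: shift_entry_nth r powr_minus powr_diff powr_nat field_simps)
    qed
    also have "\<dots> = 1 / (\<Prod>j<r. of_nat (n ! j) ^ (k ! j)) * (1 / of_nat (n ! (l - 1)) powr s)"
      using l' by (simp add: prod.distrib prod_dividef)
    finally show ?thesis by simp
  qed
  finally show ?thesis .
qed

lemma has_sum_sum:
  fixes f :: "'i \<Rightarrow> 'a \<Rightarrow> 'b :: topological_comm_monoid_add"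
  assumes "\<And>i. i \<in> I \<Longrightarrow> (f i has_sum S i) A"
  shows "((\<lambda>x. \<Sum>i\<in>I. f i x) has_sum (\<Sum>i\<in>I. S i)) A"
  using assms by (induction I rule: infinite_finite_induct) (auto intro: has_sum_add)

text \<open>
  Since \<open>|e| \<le> r - 1\<close>, the bound \<open>Re s \<ge> 2 r\<close> leaves \<open>Re (s - |e|) \<ge> r - 1\<close>, which is enough for
  every Ohno series involved to converge absolutely, so that the sums may be interchanged.
\<close>
lemma sum_ohno_series_eq_mzeta_series:
  assumes k: "admissible k" and r: "r = length k" and l: "l \<in> {1..r}" and s: "2 * real r \<le> Re s"
  shows "(\<Sum>j=0..r - 1. (-1) ^ j * (\<Sum>e\<in>shifts r l j. ohno_series (add_index k e) (s - of_nat j)))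
       = mzeta_series (shift_entry k l s)"
proof -
  let ?N = "increasing_tuples r"
  have term_has_sum: "(ohno_term (add_index k e) (s - of_nat j) i has_sum
      infsum (ohno_term (add_index k e) (s - of_nat j) i) ?N) ?N"
    if "j \<in> {0..r - 1}" "e \<in> shifts r l j" "i \<in> {..<r}" for j e i
  proof (intro has_sum_infsum summable_on_ohno_term)
    have e: "length e = length k" using that(2) by (simp add: shifts_def r)
    show "admissible (add_index k e)" "r = length (add_index k e)" "i < r"
      using admissible_add_index[OF k e] length_add_index[OF e] that r by auto
    show "real r - 1 \<le> Re (s - of_nat j)"
      using s that(1) by simp
  qed
  have "((\<lambda>n. \<Sum>j=0..r - 1. (-1) ^ j *
            (\<Sum>e\<in>shifts r l j. \<Sum>i<r. ohno_term (add_index k e) (s - of_nat j) i n)) has_sum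
        (\<Sum>j=0..r - 1. (-1) ^ j *
            (\<Sum>e\<in>shifts r l j. \<Sum>i<r. infsum (ohno_term (add_index k e) (s - of_nat j) i) ?N))) ?N"
    by (intro has_sum_sum has_sum_cmult_right term_has_sum)
  then have "((\<lambda>n. \<Prod>j<r. of_nat (n ! j) powr (- (shift_entry k l s ! j))) has_sum
        (\<Sum>j=0..r - 1. (-1) ^ j *
            (\<Sum>e\<in>shifts r l j. \<Sum>i<r. infsum (ohno_term (add_index k e) (s - of_nat j) i) ?N))) ?N"
    by (rule has_sum_cong[THEN iffD1, rotated]) (rule sum_ohno_terms[OF _ r l])
  then have "mzeta_series (shift_entry k l s) = (\<Sum>j=0..r - 1. (-1) ^ j *
            (\<Sum>e\<in>shifts r l j. \<Sum>i<r. infsum (ohno_term (add_index k e) (s - of_nat j) i) ?N))"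
    unfolding mzeta_series_def length_shift_entry r[symmetric] by (rule infsumI)
  also have "\<dots> = (\<Sum>j=0..r - 1. (-1) ^ j *
      (\<Sum>e\<in>shifts r l j. ohno_series (add_index k e) (s - of_nat j)))"
    by (intro sum.cong arg_cong2[where f = "(*)"] refl)
       (simp add: ohno_series_conv_ohno_term shifts_def length_add_index r)
  finally show ?thesis by simp
qed

section \<open>Meromorphic continuation\<close>

text \<open>
  The identity theorem for meromorphic functions: the difference takes the value \<open>0\<close> almost
  everywhere or almost nowhere, and the second is impossible near a point of \<open>U\<close>.
\<close>
lemma meromorphic_eq_on_open_imp_eq_cosparse:
  assumes "f meromorphic_on A" "g meromorphic_on A" "open A" "connected A"
    and U: "open U" "U \<subseteq> A" "U \<noteq> {}" "\<And>z. z \<in> U \<Longrightarrow> f z = g z"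
  shows "\<forall>\<^sub>\<approx>z\<in>A. f z = g z"
proof -
  have "(\<lambda>z. f z - g z) meromorphic_on A"
    by (intro meromorphic_intros assms)
  then consider "\<forall>\<^sub>\<approx>z\<in>A. f z - g z = 0" | "\<forall>\<^sub>\<approx>z\<in>A. f z - g z \<noteq> 0"
    using meromorphic_imp_constant_or_avoid[of _ A 0] assms(3,4) by blast
  then show ?thesis
  proof cases
    case 1
    then show ?thesis by eventually_elim simp
  next
    case 2
    obtain z where z: "z \<in> U" using U by blast
    then have "\<forall>\<^sub>F w in at z. f w - g w \<noteq> 0"
      using eventually_cosparse_imp_eventually_at[OF 2] U(2) by blast
    moreover have "\<forall>\<^sub>F w in at z. w \<in> U"
      using z U(1) by (intro eventually_at_in_open') auto
    ultimately have "\<forall>\<^sub>F w in at z. False"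
      by eventually_elim (use U(4) in auto)
    then show ?thesis by simp
  qed
qed

text \<open>
  By the identity theorem \<open>f\<close> agrees with \<open>g\<close> on \<open>D\<close> off a sparse set. Since \<open>g\<close> is continuous,
  taking limits with \<open>remove_sings\<close> repairs the remaining points, so that the agreement on \<open>D\<close> holds
  at every point, as a continuation requires.
\<close>
lemma remove_sings_meromorphic_continuation:
  assumes f: "f meromorphic_on UNIV" and g: "g holomorphic_on D" and D: "open D" "connected D"
    and U: "open U" "U \<subseteq> D" "U \<noteq> {}" "\<And>z. z \<in> U \<Longrightarrow> f z = g z"
  shows "meromorphic_continuation g D (remove_sings f)"
  unfolding meromorphic_continuation_def
proof (intro conjI ballI)
  show "remove_sings f meromorphic_on UNIV"
    by (rule remove_sings_meromorphic[OF f])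
  have g': "g analytic_on D" using g D(1) by (simp add: analytic_on_open)
  have eq: "\<forall>\<^sub>\<approx>z\<in>D. f z = g z"
    by (rule meromorphic_eq_on_open_imp_eq_cosparse[OF _ _ D U])
       (use f g' in \<open>auto intro: meromorphic_on_subset analytic_on_imp_meromorphic_on\<close>)
  fix z assume z: "z \<in> D"
  have "\<forall>\<^sub>F w in at z. f w = g w"
    using eq z by (rule eventually_cosparse_imp_eventually_at)
  moreover have "g \<midarrow>z\<rightarrow> g z"
    using g' z by (meson analytic_at_imp_isCont analytic_on_analytic_at isContD)
  ultimately have "f \<midarrow>z\<rightarrow> g z"
    using tendsto_cong by blast
  then show "remove_sings f z = g z" by (rule remove_sings_eqI)
qed

theorem theorem1p7:
  fixes k :: "nat list" and l :: nat and I :: "nat list \<Rightarrow> complex \<Rightarrow> complex"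
  assumes ohno_function:
      "\<And>k'. admissible k' \<Longrightarrow> meromorphic_continuation (ohno_series k') {s. Re s > -1} (I k')"
    and k: "admissible k"
    and l: "1 \<le> l" "l \<le> length k"
    and max: "\<And>m. m \<le> length k - 1 \<Longrightarrow>
        Max {abscissa (add_index k e) j | j e. j \<in> {1..length k} \<and> e \<in> shifts (length k) l m} < - int m"
  shows "\<forall>\<^sub>\<approx>s. (\<Sum>j=0..length k - 1. (-1) ^ j *
            (\<Sum>e\<in>shifts (length k) l j. I (add_index k e) (s - of_nat j)))
          = mzeta_along (shift_entry k l) s"
proof -
  define r where "r = length k"
  define f where "f s = (\<Sum>j=0..r - 1. (-1) ^ j *
      (\<Sum>e\<in>shifts r l j. I (add_index k e) (s - of_nat j)))" for s
  define g where "g s = mzeta_series (shift_entry k l s)" for s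
  define D where "D = {s. shift_entry k l s \<in> mzeta_domain}"
  define U where "U = {s. 2 * real r < Re s}"
  have I: "I (add_index k e) meromorphic_on UNIV"
    "\<And>s. -1 < Re s \<Longrightarrow> I (add_index k e) s = ohno_series (add_index k e) s"
    if "e \<in> shifts r l j" for e j
    using ohno_function[OF admissible_add_index[OF k, of e]] that
    by (auto simp: meromorphic_continuation_def shifts_def r_def)
  have f_mero: "f meromorphic_on UNIV"
    unfolding f_def
  proof (intro meromorphic_intros)
    fix j e assume "e \<in> shifts r l j"
    from I(1)[OF this] show "(\<lambda>s. I (add_index k e) (s - of_nat j)) meromorphic_on UNIV"
      by (rule meromorphic_on_compose) (auto intro!: analytic_intros)
  qed
  have f_eq_g: "f s = g s" if "s \<in> U" for s
  proof -
    have "f s = (\<Sum>j=0..r - 1. (-1) ^ j *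
        (\<Sum>e\<in>shifts r l j. ohno_series (add_index k e) (s - of_nat j)))"
      unfolding f_def using that
      by (intro sum.cong arg_cong2[where f = "(*)"] I(2)) (auto simp: U_def)
    also have "\<dots> = g s"
      unfolding g_def using l that
      by (intro sum_ohno_series_eq_mzeta_series[OF k r_def]) (auto simp: r_def U_def)
    finally show ?thesis .
  qed
  \<comment> \<open>At \<open>s = 0\<close> the exponents are \<open>k\<close> itself, so \<open>D\<close> contains the half-plane \<open>Re s \<ge> 0\<close>.\<close>
  have zero: "shift_entry k l 0 \<in> mzeta_domain"
    unfolding mzeta_domain_iff length_shift_entry
  proof safe
    fix j assume j: "j < length k"
    have "real (length k - j) < real (\<Sum>i=j..<length k. k ! i)"
      using admissible_tail_sums[OF k j] unfolding of_nat_less_iff .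
    also have "\<dots> = (\<Sum>i=j..<length k. Re (shift_entry k l 0 ! i))"
      by (simp add: shift_entry_nth)
    finally show "real (length k) - real j < (\<Sum>i=j..<length k. Re (shift_entry k l 0 ! i))"
      using j by (simp add: of_nat_diff)
  qed
  have U: "open U" "U \<subseteq> D" "U \<noteq> {}"
  proof -
    show "open U" unfolding U_def by (rule open_halfspace_Re_gt)
    show "U \<subseteq> D" using shift_entry_mzeta_domain_mono[OF zero] by (auto simp: U_def D_def)
    have "of_real (2 * real r + 1) \<in> U" by (simp add: U_def)
    then show "U \<noteq> {}" by blast
  qed
  have "meromorphic_continuation g D (remove_sings f)"
    by (rule remove_sings_meromorphic_continuation[OF f_mero _ _ _ U f_eq_g])
       (auto simp: D_def g_def[abs_def] mzeta_series_shift_entry_holomorphic open_shift_entry_mzeta_domain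
         convex_shift_entry_mzeta_domain convex_connected)
  \<comment> \<open>A continuation exists, so the one chosen by \<open>mzeta_along\<close> really is a continuation.\<close>
  then have along: "meromorphic_continuation g D (mzeta_along (shift_entry k l))"
    unfolding mzeta_along_def g_def[abs_def, symmetric] D_def[symmetric]
    by (rule someI[of "meromorphic_continuation g D"])
  have "\<forall>\<^sub>\<approx>s. f s = mzeta_along (shift_entry k l) s"
  proof (rule meromorphic_eq_on_open_imp_eq_cosparse[OF f_mero _ _ _ U(1) _ U(3)])
    show "f s = mzeta_along (shift_entry k l) s" if "s \<in> U" for s
      using along f_eq_g[OF that] that U(2) by (auto simp: meromorphic_continuation_def)
  qed (use along in \<open>auto simp: meromorphic_continuation_def\<close>)
  then show ?thesis by (simp add: f_def r_def)
qed

end
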